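(* Let $\bm{A}^{(i)}=\bigl[A^{(i)}_{rs}\bigr]_{r,s=1}^n\in\mathbb{M}_n(\mathbb{M}_k)$, $i=1,\ldots,m$, be positive definite. Then $$\det\left(\prod_{i=1}^m\circ\,\bm{A}^{(i)}\right)\ \ge\ \det\left(\prod_{i=1}^m\bm{A}^{(i)}\right)\prod_{\mu=2}^n\left(\sum_{i=1}^m\frac{\det A^{(i)}_{\mu\mu}\,\det\bm{A}^{(i)}_{\mu-1}}{\det\bm{A}^{(i)}_{\mu}}-(m-1)\right),$$ where $\bm{A}^{(i)}_{\mu}=\bigl[A^{(i)}_{rs}\bigr]_{r,s=1}^{\mu}$ stands for the $\mu\times\mu$ leading principal block submatrix of $\bm{A}^{(i)}$.
   Context: $\mathbb{M}_n(\mathbb{M}_k)$ denotes the set of $n\times n$ block matrices $\bm{A}=[A_{rs}]_{r,s=1}^n$ whose blocks $A_{rs}$ are complex $k\times k$ matrices; such a matrix is regarded as an $nk\times nk$ complex matrix, and positive definite means Hermitian positive definite as an $nk\times nk$ matrix. For matrices $A=[a_{ij}]$, $B=[b_{ij}]$ of the same size, the Hadamard product is the entrywise product $A\circ B=[a_{ij}b_{ij}]$. $\prod_{i=1}^m\circ\,\bm{A}^{(i)}$ denotes the (entrywise, $nk\times nk$) Hadamard product $\bm{A}^{(1)}\circ\cdots\circ\bm{A}^{(m)}$, while $\prod_{i=1}^m\bm{A}^{(i)}$ is the usual matrix product. $A^{(i)}_{\mu\mu}$ is the $\mu$-th diagonal $k\times k$ block of $\bm{A}^{(i)}$, and the block submatrix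 $\bm{A}^{(i)}_\mu$ has size $\mu k\times\mu k$ as a complex matrix.
   Formalization: The formal theorem assumes m ≥ 2; for m = 1 the inequality is the reverse of Fischer's and fails, e.g. n = 2, k = 1, A = [[2,1],[1,2]] would give 3 ≥ 4. *)

theory Defs
  imports
    "Jordan_Normal_Form.Determinant"
    "Jordan_Normal_Form.DL_Submatrix"
    "Jordan_Normal_Form.Schur_Decomposition"
begin

text \<open>
  The order on \<^typ>\<open>complex\<close> is that of \<^theory>\<open>HOL-Library.Complex_Order\<close>: \<open>z < w\<close> means
  \<open>Re z < Re w\<close> and \<open>Im z = Im w\<close>. In particular \<open>0 < z\<close> says that \<open>z\<close> is a positive real.
\<close>

definition pos_def_mat :: "nat \<Rightarrow> complex mat \<Rightarrow> bool" where
  "pos_def_mat N A \<longleftrightarrow>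
     A \<in> carrier_mat N N \<and> mat_adjoint A = A \<and>
     (\<forall>v \<in> carrier_vec N. v \<noteq> 0\<^sub>v N \<longrightarrow> (A *\<^sub>v v) \<bullet>c v > 0)"

definition hadamard :: "complex mat \<Rightarrow> complex mat \<Rightarrow> complex mat" where
  "hadamard A B = mat (dim_row A) (dim_col A) (\<lambda>(i, j). A $$ (i, j) * B $$ (i, j))"

text \<open>
  Iterated products \<open>A 1, \<dots>, A m\<close> of \<open>N \<times> N\<close> matrices, in this order. The neutral element of the
  Hadamard product is the all-ones matrix.
\<close>

definition hadamard_prod :: "nat \<Rightarrow> nat \<Rightarrow> (nat \<Rightarrow> complex mat) \<Rightarrow> complex mat" where
  "hadamard_prod N m A = foldr (\<lambda>i M. hadamard (A i) M) [1..<Suc m] (mat N N (\<lambda>_. 1))"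

definition matrix_prod :: "nat \<Rightarrow> nat \<Rightarrow> (nat \<Rightarrow> complex mat) \<Rightarrow> complex mat" where
  "matrix_prod N m A = foldr (\<lambda>i M. A i * M) [1..<Suc m] (1\<^sub>m N)"

text \<open>
  A block matrix with \<open>n \<times> n\<close> blocks of size \<open>k \<times> k\<close> is represented by the \<open>nk \<times> nk\<close> matrix it
  stands for. Blocks are numbered from 1, matrix entries from 0, so the block in position \<open>(r, s)\<close>
  consists of the rows \<open>(r - 1) k, \<dots>, r k - 1\<close> and the columns \<open>(s - 1) k, \<dots>, s k - 1\<close>.
\<close>

definition block :: "nat \<Rightarrow> complex mat \<Rightarrow> nat \<Rightarrow> nat \<Rightarrow> complex mat" where
  "block k A r s = submatrix A {(r - 1) * k..<r * k} {(s - 1) * k..<s * k}"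

definition leading_block_submatrix :: "nat \<Rightarrow> complex mat \<Rightarrow> nat \<Rightarrow> complex mat" where
  "leading_block_submatrix k A \<mu> = submatrix A {..<\<mu> * k} {..<\<mu> * k}"

end

theory Submission
  imports Defs
begin

text \<open>
  The pivots of the \<open>L D L\<^sup>*\<close> factorisation of a positive definite matrix are the ratios of consecutive
  scalar leading principal minors, and the pivot \<open>s\<^sub>p\<close> is the largest \<open>c\<close> for which the leading
  submatrix of size \<open>p + 1\<close> stays positive semidefinite after subtracting \<open>c\<close> from its last diagonal
  entry. Taking the Hadamard product of these semidefinite matrices over all factors (Schur product
  theorem) bounds the pivot \<open>h\<^sub>p\<close> of the Hadamard product from below by
  \<open>\<Prod>\<^sub>i a\<^sub>i\<^sub>p - \<Prod>\<^sub>i (a\<^sub>i\<^sub>p - s\<^sub>i\<^sub>p)\<close>, where \<open>a\<^sub>i\<^sub>p\<close> is the \<open>p\<close>-th diagonal entry of the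
  \<open>i\<close>-th factor. Writing \<open>a\<^sub>i\<^sub>p = s\<^sub>i\<^sub>p (1 + x\<^sub>i\<^sub>p)\<close> this is at least \<open>(\<Prod>\<^sub>i s\<^sub>i\<^sub>p) (1 + \<Sum>\<^sub>i x\<^sub>i\<^sub>p)\<close> since \<open>m \<ge> 2\<close>.
  Multiplying over the \<open>k\<close> indices of one block gives the factor
  \<open>1 + \<Sum>\<^sub>i (\<Prod>\<^sub>p (1 + x\<^sub>i\<^sub>p) - 1)\<close>, and by Hadamard's inequality
  \<open>\<Prod>\<^sub>p (1 + x\<^sub>i\<^sub>p)\<close> dominates the determinant of the diagonal block divided by the product of its
  pivots, which is the ratio in the theorem. By Fischer's inequality these ratios are at least \<open>1\<close>, so
  the bounds for the blocks are nonnegative and may be multiplied.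
\<close>

section \<open>Quadratic forms and pivots\<close>

text \<open>Matrices are functions on indices, so a leading submatrix is the same function with a
  smaller \<open>n\<close>, and a window along the diagonal is an index shift.\<close>

definition qform :: "nat \<Rightarrow> (nat \<Rightarrow> nat \<Rightarrow> complex) \<Rightarrow> (nat \<Rightarrow> complex) \<Rightarrow> complex" where
  "qform n A v = (\<Sum>i<n. \<Sum>j<n. cnj (v i) * A i j * v j)"

definition pd :: "nat \<Rightarrow> (nat \<Rightarrow> nat \<Rightarrow> complex) \<Rightarrow> bool" where
  "pd n A \<longleftrightarrow> (\<forall>i<n. \<forall>j<n. A j i = cnj (A i j)) \<and>
     (\<forall>v. (\<exists>i<n. v i \<noteq> 0) \<longrightarrow> Re (qform n A v) > 0)"

definition psd :: "nat \<Rightarrow> (nat \<Rightarrow> nat \<Rightarrow> complex) \<Rightarrow> bool" where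
  "psd n A \<longleftrightarrow> (\<forall>v. Re (qform n A v) \<ge> 0)"

text \<open>The index \<open>l > i\<close> is unbounded, so the vanishing entries include the
  columns \<open>l \<ge> n\<close>; this lets \<open>pd_ldl\<close> extend \<open>L\<close> by a
  further row. The sign of \<open>s\<close> is left open.\<close>

definition ldl :: "nat \<Rightarrow> (nat \<Rightarrow> nat \<Rightarrow> complex) \<Rightarrow> (nat \<Rightarrow> nat \<Rightarrow> complex) \<Rightarrow> (nat \<Rightarrow> real) \<Rightarrow> bool" where
  "ldl n A L s \<longleftrightarrow> (\<forall>i<n. L i i = 1) \<and> (\<forall>i<n. \<forall>l>i. L i l = 0) \<and>
     (\<forall>i<n. \<forall>j<n. A i j = (\<Sum>l<n. of_real (s l) * L i l * cnj (L j l)))"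

lemma qform_cong:
  assumes "\<And>i j. i < n \<Longrightarrow> j < n \<Longrightarrow> A i j = B i j" "\<And>i. i < n \<Longrightarrow> v i = w i"
  shows "qform n A v = qform n B w"
  unfolding qform_def using assms by (intro sum.cong refl) auto

lemma pd_hermitian: "pd n A \<Longrightarrow> i < n \<Longrightarrow> j < n \<Longrightarrow> A j i = cnj (A i j)"
  unfolding pd_def by blast

lemma pd_pos: "pd n A \<Longrightarrow> i < n \<Longrightarrow> v i \<noteq> 0 \<Longrightarrow> Re (qform n A v) > 0"
  unfolding pd_def by blast

lemma pd_imp_psd:
  assumes "pd n A"
  shows "psd n A"
  unfolding psd_def
proof
  fix v
  show "Re (qform n A v) \<ge> 0"
  proof (cases "\<exists>i<n. v i \<noteq> 0")
    case True
    then show ?thesis using pd_pos[OF assms] by (auto intro: less_imp_le)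
  next
    case False
    then show ?thesis by (simp add: qform_def)
  qed
qed

lemma qform_window:
  assumes "a + k \<le> n" "\<And>i. i < n \<Longrightarrow> \<not> (a \<le> i \<and> i < a + k) \<Longrightarrow> v i = 0"
  shows "qform n A v = qform k (\<lambda>i j. A (a + i) (a + j)) (\<lambda>i. v (a + i))"
proof -
  have shift: "(\<Sum>i\<in>{a..<a+k}. f i) = (\<Sum>i<k. f (a + i))" for f :: "nat \<Rightarrow> complex"
    using sum.shift_bounds_nat_ivl[of f 0 a k]
    by (simp add: atLeast0LessThan add.commute)
  have "qform n A v = (\<Sum>i\<in>{a..<a+k}. \<Sum>j\<in>{a..<a+k}. cnj (v i) * A i j * v j)"
    unfolding qform_def
  proof (rule sum.mono_neutral_cong_right)
    show "(\<Sum>j<n. cnj (v i) * A i j * v j) = (\<Sum>j\<in>{a..<a+k}. cnj (v i) * A i j * v j)"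
      for i using assms by (intro sum.mono_neutral_right) auto
  qed (use assms in auto)
  also have "\<dots> = qform k (\<lambda>i j. A (a + i) (a + j)) (\<lambda>i. v (a + i))"
    by (simp add: shift qform_def)
  finally show ?thesis .
qed

lemma pd_window:
  assumes "pd n A" "a + k \<le> n"
  shows "pd k (\<lambda>i j. A (a + i) (a + j))"
  unfolding pd_def
proof (intro conjI allI impI)
  fix v :: "nat \<Rightarrow> complex"
  assume "\<exists>i<k. v i \<noteq> 0"
  then obtain i where i: "i < k" "v i \<noteq> 0" by blast
  define w where "w j = (if a \<le> j \<and> j < a + k then v (j - a) else 0)" for j
  have "qform n A w = qform k (\<lambda>i j. A (a + i) (a + j)) (\<lambda>i. w (a + i))"
    by (rule qform_window) (use assms in \<open>auto simp: w_def\<close>)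
  also have "\<dots> = qform k (\<lambda>i j. A (a + i) (a + j)) v"
    by (rule qform_cong) (auto simp: w_def)
  finally have "qform n A w = \<dots>" .
  moreover have "w (a + i) \<noteq> 0" "a + i < n" using i assms by (auto simp: w_def)
  then have "Re (qform n A w) > 0" using pd_pos[OF assms(1), of "a + i" w] by simp
  ultimately show "0 < Re (qform k (\<lambda>i j. A (a + i) (a + j)) v)" by simp
qed (use assms(2) in \<open>auto intro: pd_hermitian[OF assms(1)]\<close>)

text \<open>Multiplying \<open>B\<close> entrywise by one rank-one term of \<open>G\<close> is a
  congruence of \<open>B\<close> by a diagonal matrix, and the diagonal can be absorbed into the
  vector. This is the core of the Schur product theorem.\<close>

lemma qform_hadamard_gram:
  assumes "\<And>i j. i < n \<Longrightarrow> j < n \<Longrightarrow>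
      G i j = (\<Sum>l<q. complex_of_real (s l) * L i l * cnj (L j l))"
  shows "qform n (\<lambda>i j. G i j * B i j) v =
    (\<Sum>l<q. of_real (s l) * qform n B (\<lambda>j. cnj (L j l) * v j))"
proof -
  have "qform n (\<lambda>i j. G i j * B i j) v = (\<Sum>i<n. \<Sum>j<n. \<Sum>l<q.
      of_real (s l) * (cnj (cnj (L i l) * v i) * B i j * (cnj (L j l) * v j)))"
    unfolding qform_def
    by (intro sum.cong refl) (simp add: assms sum_distrib_left sum_distrib_right mult_ac)
  also have "\<dots> = (\<Sum>i<n. \<Sum>l<q. \<Sum>j<n.
      of_real (s l) * (cnj (cnj (L i l) * v i) * B i j * (cnj (L j l) * v j)))"
    by (intro sum.cong refl sum.swap)
  also have "\<dots> = (\<Sum>l<q. \<Sum>i<n. \<Sum>j<n.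
      of_real (s l) * (cnj (cnj (L i l) * v i) * B i j * (cnj (L j l) * v j)))"
    by (rule sum.swap)
  also have "\<dots> = (\<Sum>l<q. of_real (s l) * qform n B (\<lambda>j. cnj (L j l) * v j))"
    by (simp add: qform_def sum_distrib_left)
  finally show ?thesis .
qed

lemma qform_one: "qform n (\<lambda>_ _. 1) v = of_real ((cmod (\<Sum>j<n. v j))\<^sup>2)"
proof -
  have "qform n (\<lambda>_ _. 1) v = cnj (\<Sum>j<n. v j) * (\<Sum>j<n. v j)"
    by (simp add: qform_def sum_product)
  then show ?thesis by (simp only: complex_norm_square mult.commute)
qed

lemma psd_one: "psd n (\<lambda>_ _. 1)"
  by (simp add: psd_def qform_one)

text \<open>The all-ones matrix is neutral for entrywise multiplication and its form is a squared
  modulus, so the expansion above becomes a weighted sum of squares.\<close>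

lemma qform_gram:
  assumes "\<And>i j. i < n \<Longrightarrow> j < n \<Longrightarrow>
      G i j = (\<Sum>l<q. complex_of_real (s l) * L i l * cnj (L j l))"
  shows "qform n G v = (\<Sum>l<q. of_real (s l * (cmod (\<Sum>j<n. cnj (L j l) * v j))\<^sup>2))"
  using qform_hadamard_gram[where B = "\<lambda>_ _. 1" and v = v, OF assms] by (simp add: qform_one)

lemma psd_hadamard_gram:
  assumes "\<And>i j. i < n \<Longrightarrow> j < n \<Longrightarrow>
      G i j = (\<Sum>l<q. complex_of_real (s l) * L i l * cnj (L j l))"
    and "\<And>l. l < q \<Longrightarrow> s l \<ge> 0" and "psd n B"
  shows "psd n (\<lambda>i j. G i j * B i j)"
  unfolding psd_def
proof
  fix v
  have "Re (qform n (\<lambda>i j. G i j * B i j) v) =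
      (\<Sum>l<q. s l * Re (qform n B (\<lambda>j. cnj (L j l) * v j)))"
    by (subst qform_hadamard_gram[OF assms(1)]) auto
  also have "\<dots> \<ge> 0"
    using assms(2,3) by (intro sum_nonneg) (auto simp: psd_def)
  finally show "0 \<le> Re (qform n (\<lambda>i j. G i j * B i j) v)" .
qed

section \<open>Unit triangular systems, the \<open>L D L*\<close> factorisation and
  determinants\<close>

lemma unit_lower_solve:
  fixes L :: "nat \<Rightarrow> nat \<Rightarrow> complex"
  assumes "\<And>i. i < n \<Longrightarrow> L i i = 1" "\<And>i l. i < n \<Longrightarrow> i < l \<Longrightarrow> L i l = 0"
  shows "\<exists>y. \<forall>i<n. (\<Sum>l<n. L i l * y l) = b i"
  using assms
proof (induction n)
  case (Suc n)
  have "\<exists>y. \<forall>i<n. (\<Sum>l<n. L i l * y l) = b i"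
    by (rule Suc.IH) (use Suc.prems in auto)
  then obtain y where y: "\<forall>i<n. (\<Sum>l<n. L i l * y l) = b i" by blast
  have "(\<Sum>l<Suc n. L i l * (y(n := b n - (\<Sum>l<n. L n l * y l))) l) = b i" if "i < Suc n" for i
    using that y Suc.prems by (cases "i = n") auto
  then show ?case by blast
qed simp

lemma unit_upper_solve:
  fixes L :: "nat \<Rightarrow> nat \<Rightarrow> complex"
  assumes "\<And>i. i < n \<Longrightarrow> L i i = 1" "\<And>i l. i < n \<Longrightarrow> i < l \<Longrightarrow> L i l = 0"
  shows "\<exists>x. \<forall>l<n. (\<Sum>i<n. L i l * x i) = b l"
  using assms
\<comment> \<open>Back substitution fixes the last unknown first and moves it to the right-hand
  side, so \<open>b\<close> has to vary.\<close>
proof (induction n arbitrary: b)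
  case (Suc n)
  have "\<exists>x. \<forall>l<n. (\<Sum>i<n. L i l * x i) = b l - L n l * b n"
    by (rule Suc.IH) (use Suc.prems in auto)
  then obtain x where x: "\<forall>l<n. (\<Sum>i<n. L i l * x i) = b l - L n l * b n" by blast
  have "(\<Sum>i<Suc n. L i l * (x(n := b n)) i) = b l" if "l < Suc n" for l
    using that x Suc.prems by (cases "l = n") auto
  then show ?case by blast
qed simp

lemma ldl_leading:
  assumes "ldl n A L s" "p \<le> n"
  shows "ldl p A L s"
proof -
  have "(\<Sum>l<n. of_real (s l) * L i l * cnj (L j l)) = (\<Sum>l<p. of_real (s l) * L i l * cnj (L j l))"
    if "i < p" for i j
    using assms that by (intro sum.mono_neutral_right) (auto simp: ldl_def)
  then show ?thesis using assms by (auto simp: ldl_def)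
qed

text \<open>The conjugate transpose of \<open>L\<close> maps the test vector to the
  \<open>p\<close>-th unit vector, so only the weight \<open>s p\<close> survives in the sum of
  squares. No sign of \<open>s\<close> enters, and \<open>pd_ldl\<close> can use this to prove a new
  pivot positive.\<close>

lemma pivot_attained:
  assumes "ldl n A L s" "p < n"
  shows "\<exists>v. v p = 1 \<and> qform (Suc p) A v = of_real (s p)"
proof -
  have ldl: "ldl (Suc p) A L s" using ldl_leading[OF assms(1), of "Suc p"] assms(2) by simp
  have "\<exists>v. \<forall>l<Suc p. (\<Sum>i<Suc p. cnj (L i l) * v i) = (if l = p then 1 else 0)"
    using ldl by (intro unit_upper_solve[where L = "\<lambda>i l. cnj (L i l)"]) (auto simp: ldl_def)
  then obtain v where v: "\<And>l. l < Suc p \<Longrightarrow>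
      (\<Sum>i<Suc p. cnj (L i l) * v i) = (if l = p then 1 else 0)" by blast
  \<comment> \<open>These entries of \<open>L\<close> lie above the diagonal, so equation
    \<open>l = p\<close> reduces to its term \<open>i = p\<close>.\<close>
  have "(\<Sum>i<p. cnj (L i p) * v i) = 0"
    using ldl by (intro sum.neutral) (auto simp: ldl_def)
  then have vp: "v p = 1" using v[of p] ldl by (simp add: ldl_def)
  have "qform (Suc p) A v =
      (\<Sum>l<Suc p. of_real (s l * (cmod (\<Sum>j<Suc p. cnj (L j l) * v j))\<^sup>2))"
    using ldl by (intro qform_gram) (auto simp: ldl_def)
  also have "\<dots> = (\<Sum>l<Suc p. if l = p then of_real (s p) else 0)"
    by (intro sum.cong refl, subst v) auto
  also have "\<dots> = of_real (s p)" by simp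
  finally show ?thesis using vp by blast
qed

text \<open>Within these indices the rank-one term \<open>l = p\<close> lives only in the corner
  \<open>(p, p)\<close>, where it equals \<open>s p\<close>; subtracting the pivot removes exactly
  this term.\<close>

lemma ldl_sub_pivot:
  assumes "ldl n A L s" "p < n" "i \<le> p" "j \<le> p"
  shows "A i j - (if i = p \<and> j = p then of_real (s p) else 0) =
    (\<Sum>l<p. of_real (s l) * L i l * cnj (L j l))"
proof -
  have "ldl (Suc p) A L s" using ldl_leading[OF assms(1), of "Suc p"] assms(2) by simp
  with assms(3,4) show ?thesis
    by (cases "i = p"; cases "j = p") (auto simp: ldl_def)
qed

text \<open>Induction by bordering: the factorisation of the leading part gains one row of
  \<open>L\<close> and one pivot.\<close>

lemma pd_ldl:
  assumes "pd n A"
  shows "\<exists>L s. ldl n A L s \<and> (\<forall>l<n. s l > 0)"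
  using assms
proof (induction n)
  case 0
  then show ?case by (simp add: ldl_def)
next
  case (Suc n)
  have "pd n A" using pd_window[OF Suc.prems, of 0 n] by simp
  then obtain L s where ldl: "ldl n A L s" and s: "\<And>l. l < n \<Longrightarrow> s l > 0"
    using Suc.IH by blast
  have herm: "A j i = cnj (A i j)" if "i < Suc n" "j < Suc n" for i j
    using pd_hermitian[OF Suc.prems that] .
  \<comment> \<open>With \<open>y l\<close> standing for \<open>s l * cnj (r l)\<close>, the
    condition on the new row \<open>r\<close> becomes a unit triangular system.\<close>
  obtain y where y: "\<And>i. i < n \<Longrightarrow> (\<Sum>l<n. L i l * y l) = A i n"
    using unit_lower_solve[of n L "\<lambda>i. A i n"] ldl by (auto simp: ldl_def)
  define r where "r l = (if l < n then cnj (y l) / of_real (s l) else if l = n then 1 else 0)" for l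
  \<comment> \<open>The new pivot is what the earlier terms leave of the corner entry, the Schur
    complement of the leading part.\<close>
  define d where "d = Re (A n n) - (\<Sum>l<n. s l * (cmod (r l))\<^sup>2)"
  have row: "(\<Sum>l<n. of_real (s l) * L i l * cnj (r l)) = A i n" if "i < n" for i
  proof -
    have "of_real (s l) * L i l * cnj (r l) = L i l * y l" if "l < n" for l
      using s[OF that] that by (simp add: r_def)
    then have "(\<Sum>l<n. of_real (s l) * L i l * cnj (r l)) = (\<Sum>l<n. L i l * y l)"
      by (intro sum.cong) auto
    then show ?thesis using y[OF that] by simp
  qed
  have col: "(\<Sum>l<n. of_real (s l) * r l * cnj (L j l)) = A n j" if "j < n" for j
  proof -
    have "A n j = cnj (\<Sum>l<n. of_real (s l) * L j l * cnj (r l))"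
      using row[OF that] herm[of j n] that by simp
    then show ?thesis by (simp add: cnj_sum mult_ac)
  qed
  have corner: "(\<Sum>l<n. of_real (s l) * r l * cnj (r l)) + of_real d = A n n"
  proof -
    have "(\<Sum>l<n. of_real (s l) * r l * cnj (r l)) = of_real (\<Sum>l<n. s l * (cmod (r l))\<^sup>2)"
      unfolding of_real_sum of_real_mult complex_norm_square by (simp add: mult_ac)
    moreover have "A n n = of_real (Re (A n n))"
      using herm[of n n] by (simp add: complex_eq_iff)
    ultimately show ?thesis by (simp add: d_def)
  qed
  have new: "ldl (Suc n) A (L(n := r)) (s(n := d))"
    unfolding ldl_def
  proof (intro conjI allI impI)
    fix i j assume "i < Suc n" "j < Suc n"
    moreover have "(\<Sum>l<n. of_real ((s(n := d)) l) * x l) = (\<Sum>l<n. of_real (s l) * x l)"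
      for x :: "nat \<Rightarrow> complex" by (intro sum.cong) auto
    note this[simp]
    ultimately show "A i j =
        (\<Sum>l<Suc n. of_real ((s(n := d)) l) * (L(n := r)) i l * cnj ((L(n := r)) j l))"
      using ldl row col corner
      by (cases "i = n"; cases "j = n") (auto simp: ldl_def r_def[of n] mult.assoc)
  qed (use ldl in \<open>auto simp: ldl_def r_def\<close>)
  \<comment> \<open>The form takes the value \<open>d\<close> at a nonzero vector, so definiteness
    of \<open>A\<close> makes the new pivot positive.\<close>
  obtain v where v: "v n = 1" "qform (Suc n) A v = of_real d"
    using pivot_attained[OF new, of n] by auto
  have "Re (qform (Suc n) A v) > 0"
    using pd_pos[OF Suc.prems, of n v] v(1) by simp
  then have "\<forall>l<Suc n. (s(n := d)) l > 0" using v s by (auto simp: less_Suc_eq)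
  with new show ?case by blast
qed

text \<open>The matrix is the product of a unit lower triangular matrix and an upper triangular one
  that carries the pivots on its diagonal.\<close>

lemma det_ldl:
  assumes "ldl n A L s"
  shows "det (mat n n (\<lambda>(i, j). A i j)) = of_real (\<Prod>l<n. s l)"
proof -
  define P where "P = mat n n (\<lambda>(i, l). L i l)"
  define Q where "Q = mat n n (\<lambda>(l, j). of_real (s l) * cnj (L j l))"
  have PQ: "P \<in> carrier_mat n n" "Q \<in> carrier_mat n n" by (auto simp: P_def Q_def)
  have "mat n n (\<lambda>(i, j). A i j) = P * Q"
    using assms
    by (intro eq_matI)
      (auto simp: P_def Q_def ldl_def scalar_prod_def atLeast0LessThan mult_ac)
  then have "det (mat n n (\<lambda>(i, j). A i j)) = det P * det Q"
    using det_mult[OF PQ] by simp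
  also have "det P = prod_list (diag_mat P)"
    by (rule det_lower_triangular[OF _ PQ(1)]) (use assms in \<open>auto simp: P_def ldl_def\<close>)
  also have "\<dots> = 1"
    unfolding prod_list_diag_prod
    by (rule prod.neutral) (use assms in \<open>auto simp: P_def ldl_def\<close>)
  also have "det Q = prod_list (diag_mat Q)"
    by (rule det_upper_triangular[OF _ PQ(2)]) (use assms in \<open>auto simp: Q_def ldl_def\<close>)
  also have "\<dots> = of_real (\<Prod>l<n. s l)"
    unfolding prod_list_diag_prod of_real_prod
    by (rule prod.cong) (use assms in \<open>auto simp: Q_def ldl_def\<close>)
  finally show ?thesis by simp
qed

text \<open>One strictly positive term suffices: if \<open>v p \<noteq> 0\<close>, the
  \<open>p\<close>-th rescaled vector keeps the entry \<open>v p\<close>, since the diagonal of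
  \<open>L\<close> is one.\<close>

lemma pd_hadamard:
  assumes "pd n A" "pd n B"
  shows "pd n (\<lambda>i j. A i j * B i j)"
  unfolding pd_def
proof (intro conjI allI impI)
  fix v :: "nat \<Rightarrow> complex"
  assume "\<exists>i<n. v i \<noteq> 0"
  then obtain p where p: "p < n" "v p \<noteq> 0" by blast
  obtain L s where ldl: "ldl n A L s" and s: "\<And>l. l < n \<Longrightarrow> s l > 0"
    using pd_ldl[OF assms(1)] by blast
  let ?w = "\<lambda>l j. cnj (L j l) * v j"
  have "qform n (\<lambda>i j. A i j * B i j) v = (\<Sum>l<n. of_real (s l) * qform n B (?w l))"
    using ldl by (intro qform_hadamard_gram) (auto simp: ldl_def)
  then have "Re (qform n (\<lambda>i j. A i j * B i j) v) = (\<Sum>l<n. s l * Re (qform n B (?w l)))"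
    by simp
  moreover have "?w p p \<noteq> 0" using ldl p by (simp add: ldl_def)
  then have "Re (qform n B (?w p)) > 0" by (rule pd_pos[OF assms(2) p(1)])
  then have "s p * Re (qform n B (?w p)) > 0" using s p by simp
  moreover have "s l * Re (qform n B (?w l)) \<ge> 0" if "l < n" for l
    using s[OF that] pd_imp_psd[OF assms(2)] by (simp add: psd_def)
  ultimately show "0 < Re (qform n (\<lambda>i j. A i j * B i j) v)"
    using p(1) by (auto intro!: sum_pos2[of _ p])
next
  fix i j
  assume "i < n" "j < n"
  then show "A j i * B j i = cnj (A i j * B i j)"
    using pd_hermitian[OF assms(1)] pd_hermitian[OF assms(2)] by (metis complex_cnj_mult)
qed

text \<open>\<open>I\<close> is nonempty because the empty product is the all-ones matrix, which is
  singular for \<open>n > 1\<close>.\<close>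

lemma pd_hadamard_prod:
  assumes "finite I" "I \<noteq> {}" "\<And>i. i \<in> I \<Longrightarrow> pd n (A i)"
  shows "pd n (\<lambda>p q. \<Prod>i\<in>I. A i p q)"
  using assms by (induction rule: finite_ne_induct) (auto intro!: pd_hadamard)

section \<open>Comparison of pivots through semidefinite matrices\<close>

lemma pivot_ge:
  assumes "ldl n A L s" "p < n"
    and "psd (Suc p) (\<lambda>i j. A i j - (if i = p \<and> j = p then of_real c else 0))"
  shows "s p \<ge> c"
proof -
  \<comment> \<open>Since \<open>v p = 1\<close>, lowering the corner by \<open>c\<close> lowers the
    form at this vector from \<open>s p\<close> to \<open>s p - c\<close>.\<close>
  obtain v where v: "v p = 1" "qform (Suc p) A v = of_real (s p)"
    using pivot_attained[OF assms(1,2)] by blast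
  have "qform (Suc p) (\<lambda>i j. A i j - (if i = p \<and> j = p then of_real c else 0)) v =
    qform (Suc p) A v -
      (\<Sum>i<Suc p. \<Sum>j<Suc p. if j = p then if i = p then of_real c else 0 else 0)"
    unfolding qform_def sum_subtractf[symmetric]
    by (intro sum.cong refl) (auto simp: algebra_simps v)
  also have "\<dots> = of_real (s p - c)"
    by (subst sum.delta) (auto simp: v)
  finally show ?thesis using assms(3)[unfolded psd_def, rule_format, of v] by simp
qed

text \<open>By \<open>ldl_sub_pivot\<close> each reduced factor is a Gram sum with positive weights,
  so the factors can be multiplied in one at a time, starting from the all-ones matrix.\<close>

lemma psd_sub_pivots:
  assumes "finite I" "\<And>i. i \<in> I \<Longrightarrow> ldl n (A i) (L i) (s i)"
    "\<And>i l. i \<in> I \<Longrightarrow> l < n \<Longrightarrow> s i l > 0" "p < n"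
  shows "psd (Suc p) (\<lambda>a b. \<Prod>i\<in>I. (A i a b - (if a = p \<and> b = p then of_real (s i p) else 0)))"
  using assms(1-3)
proof (induction rule: finite_induct)
  case empty
  then show ?case by (simp add: psd_one)
next
  case (insert i I)
  have "psd (Suc p) (\<lambda>a b. (A i a b - (if a = p \<and> b = p then of_real (s i p) else 0)) *
     (\<Prod>i\<in>I. (A i a b - (if a = p \<and> b = p then of_real (s i p) else 0))))"
    using insert assms(4)
    by (intro psd_hadamard_gram[where q = p and s = "s i" and L = "L i"] ldl_sub_pivot[of n])
      (auto simp: less_imp_le)
  with insert.hyps show ?case by simp
qed

text \<open>The diagonal entry exceeds the pivot by the earlier terms of its expansion, which are
  weighted squares.\<close>

lemma pivot_le_diagonal:
  assumes "ldl n A L s" "\<And>l. l < n \<Longrightarrow> s l > 0" "p < n"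
  shows "A p p = of_real (Re (A p p))" "s p \<le> Re (A p p)"
proof -
  have "A p p - of_real (s p) = (\<Sum>l<p. of_real (s l) * L p l * cnj (L p l))"
    using ldl_sub_pivot[OF assms(1,3), of p p] by simp
  also have "\<dots> = of_real (\<Sum>l<p. s l * (cmod (L p l))\<^sup>2)"
    unfolding of_real_sum of_real_mult complex_norm_square by (simp add: mult_ac)
  finally have eq: "A p p = of_real (s p + (\<Sum>l<p. s l * (cmod (L p l))\<^sup>2))"
    by (simp add: algebra_simps)
  show "A p p = of_real (Re (A p p))" unfolding eq by simp
  have "(\<Sum>l<p. s l * (cmod (L p l))\<^sup>2) \<ge> 0"
    using assms(2,3) by (intro sum_nonneg mult_nonneg_nonneg) (auto intro: less_imp_le)
  then show "s p \<le> Re (A p p)" unfolding eq by simp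
qed

lemma pivot_hadamard_ge:
  assumes "finite I" "\<And>i. i \<in> I \<Longrightarrow> ldl n (A i) (L i) (s i)"
    "\<And>i l. i \<in> I \<Longrightarrow> l < n \<Longrightarrow> s i l > 0" "p < n"
    and "ldl n (\<lambda>a b. \<Prod>i\<in>I. A i a b) M h"
  shows "h p \<ge> (\<Prod>i\<in>I. Re (A i p p)) - (\<Prod>i\<in>I. Re (A i p p) - s i p)"
proof (rule pivot_ge[OF assms(5,4)])
  let ?c = "(\<Prod>i\<in>I. Re (A i p p)) - (\<Prod>i\<in>I. Re (A i p p) - s i p)"
  have diag: "A i p p = of_real (Re (A i p p))" if "i \<in> I" for i
    using pivot_le_diagonal(1)[OF assms(2)[OF that] assms(3)[OF that] assms(4)] .
  have "(\<Prod>i\<in>I. A i p p) = of_real (\<Prod>i\<in>I. Re (A i p p))"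
    unfolding of_real_prod using diag by (intro prod.cong) auto
  moreover have "(\<Prod>i\<in>I. A i p p - of_real (s i p)) = of_real (\<Prod>i\<in>I. Re (A i p p) - s i p)"
    unfolding of_real_prod using diag by (intro prod.cong) auto
  \<comment> \<open>The reductions touch only the corner \<open>(p, p)\<close>, so the product of
    the reduced factors is the full product with its corner lowered by \<open>?c\<close>.\<close>
  ultimately have
    "(\<Prod>i\<in>I. (A i a b - (if a = p \<and> b = p then of_real (s i p) else 0))) =
      (\<Prod>i\<in>I. A i a b) - (if a = p \<and> b = p then of_real ?c else 0)" for a b
    by auto
  then show "psd (Suc p) (\<lambda>a b. (\<Prod>i\<in>I. A i a b) - (if a = p \<and> b = p then of_real ?c else 0))"
    using psd_sub_pivots[of I n A L s p] assms by simp
qed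

text \<open>Eliminating fewer preceding variables can only enlarge a pivot: the window is tested
  only on vectors that vanish before index \<open>a\<close>. Multiplying these comparisons gives
  Fischer's inequality.\<close>

lemma pivot_le_window_pivot:
  assumes "ldl n A L s" "\<And>l. l < n \<Longrightarrow> s l > 0"
    and "ldl k (\<lambda>i j. A (a + i) (a + j)) M t" "a + k \<le> n" "q < k"
  shows "s (a + q) \<le> t q"
proof (rule pivot_ge[OF assms(3,5)])
  let ?p = "a + q"
  let ?B = "\<lambda>i j. A i j - (if i = ?p \<and> j = ?p then of_real (s ?p) else 0)"
  \<comment> \<open>A one-element index set specialises the result on products to the single matrix
    \<open>A\<close>.\<close>
  have "psd (Suc ?p) ?B"
    using psd_sub_pivots[of "{()}" n "\<lambda>_. A" "\<lambda>_. L" "\<lambda>_. s" ?p] assms by simp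
  then have psd: "Re (qform (Suc ?p) ?B w) \<ge> 0" for w by (simp add: psd_def)
  show "psd (Suc q) (\<lambda>i j. A (a + i) (a + j) - (if i = q \<and> j = q then of_real (s (a + q)) else 0))"
    unfolding psd_def
  proof
    fix v
    let ?w = "\<lambda>j. if a \<le> j then v (j - a) else 0 :: complex"
    have "qform (Suc ?p) ?B ?w = qform (Suc q) (\<lambda>i j. ?B (a + i) (a + j)) (\<lambda>i. ?w (a + i))"
      by (rule qform_window) auto
    then show "0 \<le> Re (qform (Suc q)
        (\<lambda>i j. A (a + i) (a + j) - (if i = q \<and> j = q then of_real (s (a + q)) else 0)) v)"
      using psd[of ?w] by simp
  qed
qed

section \<open>Product inequalities\<close>

text \<open>For \<open>m = 2\<close> this is an equality, while for \<open>m = 1\<close> it fails as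
  soon as \<open>x 1 > 0\<close>; hence the induction starts at 2.\<close>

lemma prod_add_one_minus_prod_ge:
  fixes x :: "nat \<Rightarrow> real"
  assumes "m \<ge> 2" "\<And>i. i \<in> {1..m} \<Longrightarrow> x i \<ge> 0"
  shows "(\<Prod>i=1..m. 1 + x i) - (\<Prod>i=1..m. x i) \<ge> 1 + (\<Sum>i=1..m. x i)"
  using assms
proof (induction m rule: dec_induct)
  case base
  have "{1..2::nat} = {1, 2}" by auto
  then show ?case by (simp add: algebra_simps)
next
  case (step m)
  let ?P = "\<Prod>i=1..m. 1 + x i" and ?Q = "\<Prod>i=1..m. x i" and ?y = "x (Suc m)"
  have "0 \<le> ?y" "0 \<le> ?Q" "0 \<le> (\<Sum>i=1..m. x i)"
    using step.prems by (auto intro!: prod_nonneg sum_nonneg)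
  moreover have "?P - ?Q \<ge> 1 + (\<Sum>i=1..m. x i)" using step by auto
  \<comment> \<open>The larger side is the new difference \<open>(1 + ?y) * ?P - ?y * ?Q\<close>,
    regrouped so that the induction hypothesis applies.\<close>
  ultimately have "(1 + ?y) * (?P - ?Q) + ?Q \<ge> (1 + ?y) * (1 + (\<Sum>i=1..m. x i))"
    by (smt (verit) mult_left_mono)
  moreover have "(1 + ?y) * (1 + (\<Sum>i=1..m. x i)) \<ge> 1 + (\<Sum>i=1..m. x i) + ?y"
    using \<open>0 \<le> ?y\<close> \<open>0 \<le> (\<Sum>i=1..m. x i)\<close> by (simp add: algebra_simps)
  ultimately show ?case by (simp add: algebra_simps)
qed

text \<open>Expanding the larger product yields every monomial of the smaller side, together with
  mixed ones that combine several \<open>i\<close>; all are nonnegative.\<close>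

lemma prod_one_plus_sum_ge:
  fixes x :: "'i \<Rightarrow> 'p \<Rightarrow> real"
  assumes "finite B" "finite I" "\<And>i p. i \<in> I \<Longrightarrow> p \<in> B \<Longrightarrow> x i p \<ge> 0"
  shows "(\<Prod>p\<in>B. 1 + (\<Sum>i\<in>I. x i p)) \<ge> 1 + (\<Sum>i\<in>I. (\<Prod>p\<in>B. 1 + x i p) - 1)"
  using assms(1,3)
proof (induction rule: finite_induct)
  case (insert q B)
  let ?P = "\<lambda>i. (\<Prod>p\<in>B. 1 + x i p) - 1"
  have P: "?P i \<ge> 0" if "i \<in> I" for i
    using insert.prems that prod_ge_1[of B "\<lambda>p. 1 + x i p"] by simp
  have y: "x i q \<ge> 0" if "i \<in> I" for i using insert.prems that by simp
  have "(\<Sum>i\<in>I. ?P i * x i q) \<le> (\<Sum>i\<in>I. ?P i * (\<Sum>j\<in>I. x j q))"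
    using P y assms(2) by (intro sum_mono mult_left_mono member_le_sum) auto
  also have "\<dots> = (\<Sum>i\<in>I. ?P i) * (\<Sum>j\<in>I. x j q)" by (simp add: sum_distrib_right)
  finally have "1 + (\<Sum>i\<in>I. ?P i) + (\<Sum>j\<in>I. x j q) + (\<Sum>i\<in>I. ?P i * x i q) \<le>
      (1 + (\<Sum>j\<in>I. x j q)) * (1 + (\<Sum>i\<in>I. ?P i))"
    by (simp add: algebra_simps)
  also have "\<dots> \<le> (1 + (\<Sum>j\<in>I. x j q)) * (\<Prod>p\<in>B. 1 + (\<Sum>i\<in>I. x i p))"
    using insert y by (intro mult_left_mono) (auto intro!: add_nonneg_nonneg sum_nonneg)
  finally show ?case
    using insert.hyps by (simp add: algebra_simps sum.distrib sum_subtractf)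
qed simp

text \<open>The estimate for one block: \<open>a\<close> holds diagonal entries, \<open>s\<close>
  pivots, \<open>h\<close> pivots of the Hadamard product and \<open>b\<close> determinants of
  diagonal blocks. The bound \<open>F \<ge> 1\<close> allows the estimates of different blocks to be
  multiplied.\<close>

lemma prod_pivot_lower_bound:
  fixes a s :: "nat \<Rightarrow> nat \<Rightarrow> real"
  assumes "m \<ge> 2" "finite B"
    and s: "\<And>i p. i \<in> {1..m} \<Longrightarrow> p \<in> B \<Longrightarrow> 0 < s i p"
    and sa: "\<And>i p. i \<in> {1..m} \<Longrightarrow> p \<in> B \<Longrightarrow> s i p \<le> a i p"
    and h: "\<And>p. p \<in> B \<Longrightarrow> h p \<ge> (\<Prod>i=1..m. a i p) - (\<Prod>i=1..m. a i p - s i p)"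
    and b: "\<And>i. i \<in> {1..m} \<Longrightarrow> (\<Prod>p\<in>B. s i p) \<le> b i"
      "\<And>i. i \<in> {1..m} \<Longrightarrow> b i \<le> (\<Prod>p\<in>B. a i p)"
  defines "F \<equiv> (\<Sum>i=1..m. b i / (\<Prod>p\<in>B. s i p)) - (real m - 1)"
  shows "F \<ge> 1" "(\<Prod>p\<in>B. h p) \<ge> (\<Prod>i=1..m. \<Prod>p\<in>B. s i p) * F"
proof -
  \<comment> \<open>\<open>x i p\<close> is the relative excess of the diagonal entry over the
    pivot; with it the product of pivots factors out of both products in \<open>h\<close>.\<close>
  define x where "x i p = a i p / s i p - 1" for i p
  have x: "x i p \<ge> 0" "a i p = s i p * (1 + x i p)" "a i p - s i p = s i p * x i p"
    if "i \<in> {1..m}" "p \<in> B" for i p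
    using s[OF that] sa[OF that] by (auto simp: x_def field_simps)
  have S: "(\<Prod>p\<in>B. s i p) > 0" if "i \<in> {1..m}" for i using s that by (intro prod_pos) auto
  have F: "F = 1 + (\<Sum>i=1..m. b i / (\<Prod>p\<in>B. s i p) - 1)"
    by (simp add: F_def sum_subtractf)
  have "(\<Sum>i=1..m. b i / (\<Prod>p\<in>B. s i p) - 1) \<ge> 0"
    using b(1) S by (intro sum_nonneg) simp
  then show "F \<ge> 1" by (simp add: F)
  have hp: "h p \<ge> (\<Prod>i=1..m. s i p) * (1 + (\<Sum>i=1..m. x i p))" if "p \<in> B" for p
  proof -
    have "(\<Prod>i=1..m. a i p) = (\<Prod>i=1..m. s i p) * (\<Prod>i=1..m. 1 + x i p)"
      unfolding prod.distrib[symmetric] using x(2) that by (intro prod.cong) auto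
    moreover have "(\<Prod>i=1..m. a i p - s i p) = (\<Prod>i=1..m. s i p) * (\<Prod>i=1..m. x i p)"
      unfolding prod.distrib[symmetric] using x(3) that by (intro prod.cong) auto
    ultimately have "h p \<ge> (\<Prod>i=1..m. s i p) * ((\<Prod>i=1..m. 1 + x i p) - (\<Prod>i=1..m. x i p))"
      using h[OF that] by (simp add: right_diff_distrib)
    moreover have "(\<Prod>i=1..m. s i p) \<ge> 0"
      using s that by (intro prod_nonneg) (auto intro: less_imp_le)
    ultimately show ?thesis
      using mult_left_mono[OF prod_add_one_minus_prod_ge[of m "\<lambda>i. x i p"], of "\<Prod>i=1..m. s i p"]
        assms(1) x(1) that by force
  qed
  have "b i / (\<Prod>p\<in>B. s i p) \<le> (\<Prod>p\<in>B. 1 + x i p)" if "i \<in> {1..m}" for i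
  proof -
    have "(\<Prod>p\<in>B. a i p) = (\<Prod>p\<in>B. s i p) * (\<Prod>p\<in>B. 1 + x i p)"
      unfolding prod.distrib[symmetric] using x(2) that by (intro prod.cong) auto
    then show ?thesis using b(2)[OF that] S[OF that] by (simp add: divide_le_eq mult.commute)
  qed
  then have "F \<le> 1 + (\<Sum>i=1..m. (\<Prod>p\<in>B. 1 + x i p) - 1)"
    unfolding F by (intro add_left_mono sum_mono diff_right_mono) auto
  also have "\<dots> \<le> (\<Prod>p\<in>B. 1 + (\<Sum>i=1..m. x i p))"
    using assms(2) x(1) by (intro prod_one_plus_sum_ge) auto
  finally have "F \<le> (\<Prod>p\<in>B. 1 + (\<Sum>i=1..m. x i p))" .
  moreover have "(\<Prod>i=1..m. \<Prod>p\<in>B. s i p) \<ge> 0"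
    by (intro prod_nonneg less_imp_le[OF S])
  ultimately have "(\<Prod>i=1..m. \<Prod>p\<in>B. s i p) * F \<le>
      (\<Prod>i=1..m. \<Prod>p\<in>B. s i p) * (\<Prod>p\<in>B. 1 + (\<Sum>i=1..m. x i p))"
    by (rule mult_left_mono)
  also have "\<dots> = (\<Prod>p\<in>B. (\<Prod>i=1..m. s i p) * (1 + (\<Sum>i=1..m. x i p)))"
    by (simp add: prod.distrib prod.swap[of _ B])
  also have "\<dots> \<le> (\<Prod>p\<in>B. h p)"
    using hp s x(1)
    by (intro prod_mono conjI mult_nonneg_nonneg prod_nonneg add_nonneg_nonneg sum_nonneg)
      (auto intro: less_imp_le)
  finally show "(\<Prod>p\<in>B. h p) \<ge> (\<Prod>i=1..m. \<Prod>p\<in>B. s i p) * F" .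
qed

section \<open>Translation to matrices\<close>

lemma pick_atLeastLessThan:
  assumes "i < b - a"
  shows "pick {a..<b} i = a + i"
proof -
  have "{x \<in> {a..<b}. x < a + i} = {a..<a + i}" using assms by auto
  then show ?thesis using pick_card_in_set[of "a + i" "{a..<b}"] assms by simp
qed

lemma submatrix_window:
  assumes "M \<in> carrier_mat N N" "b \<le> N"
  shows "submatrix M {a..<b} {a..<b} = mat (b - a) (b - a) (\<lambda>(i, j). M $$ (a + i, a + j))"
proof -
  have "{i. i < N \<and> a \<le> i \<and> i < b} = {a..<b}" using assms by auto
  then show ?thesis
    using assms by (intro eq_matI) (auto simp: submatrix_def pick_atLeastLessThan)
qed

lemma block_eq:
  assumes "M \<in> carrier_mat (n * k) (n * k)" "\<mu> < n"
  shows "block k M (Suc \<mu>) (Suc \<mu>) = mat k k (\<lambda>(i, j). M $$ (\<mu> * k + i, \<mu> * k + j))"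
proof -
  have "Suc \<mu> * k \<le> n * k" using assms(2) by (intro mult_le_mono1) simp
  then show ?thesis
    unfolding block_def using submatrix_window[OF assms(1), of "Suc \<mu> * k" "\<mu> * k"] by simp
qed

lemma leading_block_submatrix_eq:
  assumes "M \<in> carrier_mat (n * k) (n * k)" "\<mu> \<le> n"
  shows "leading_block_submatrix k M \<mu> = mat (\<mu> * k) (\<mu> * k) (\<lambda>(i, j). M $$ (i, j))"
  unfolding leading_block_submatrix_def
  using submatrix_window[OF assms(1), of "\<mu> * k" 0] assms(2) by (simp add: atLeast0LessThan)

lemma hadamard_prod_eq:
  "hadamard_prod N m A = mat N N (\<lambda>(p, q). \<Prod>i=1..m. A i $$ (p, q))"
  if "\<And>i. i \<in> {1..m} \<Longrightarrow> A i \<in> carrier_mat N N"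
proof -
  have "foldr (\<lambda>i M. hadamard (A i) M) xs (mat N N (\<lambda>_. 1)) =
      mat N N (\<lambda>(p, q). prod_list (map (\<lambda>i. A i $$ (p, q)) xs))"
    if "\<forall>i\<in>set xs. A i \<in> carrier_mat N N" for xs
    using that by (induction xs) (auto simp: hadamard_def intro!: eq_matI)
  from this[of "[1..<Suc m]"] that show ?thesis
    unfolding hadamard_prod_def
    by (auto simp: prod.distinct_set_conv_list[symmetric] atLeastLessThanSuc_atLeastAtMost
        simp del: upt_Suc)
qed

lemma det_matrix_prod:
  assumes "\<And>i. i \<in> {1..m} \<Longrightarrow> A i \<in> carrier_mat N N"
  shows "det (matrix_prod N m A) = (\<Prod>i=1..m. det (A i))"
proof -
  have "foldr (\<lambda>i M. A i * M) xs (1\<^sub>m N) \<in> carrier_mat N N \<and>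
      det (foldr (\<lambda>i M. A i * M) xs (1\<^sub>m N)) = prod_list (map (\<lambda>i. det (A i)) xs)"
    if "\<forall>i\<in>set xs. A i \<in> carrier_mat N N" for xs
    using that
  proof (induction xs)
    case (Cons i xs)
    then show ?case by (auto simp: det_mult[of _ N])
  qed simp
  from this[of "[1..<Suc m]"] assms show ?thesis
    unfolding matrix_prod_def
    by (auto simp: prod.distinct_set_conv_list[symmetric] atLeastLessThanSuc_atLeastAtMost
        simp del: upt_Suc)
qed

lemma mat_adjoint_index:
  assumes "M \<in> carrier_mat N N" "i < N" "j < N"
  shows "mat_adjoint M $$ (i, j) = cnj (M $$ (j, i))"
  using assms by (auto simp: mat_adjoint_def mat_of_rows_def)

lemma pos_def_mat_imp_pd:
  assumes "pos_def_mat N M"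
  shows "pd N (\<lambda>i j. M $$ (i, j))"
  unfolding pd_def
proof (intro conjI allI impI)
  have M: "M \<in> carrier_mat N N" "mat_adjoint M = M" using assms by (auto simp: pos_def_mat_def)
  show "M $$ (j, i) = cnj (M $$ (i, j))" if "i < N" "j < N" for i j
    using mat_adjoint_index[OF M(1) that(2,1)] M(2) by simp
  fix v :: "nat \<Rightarrow> complex"
  assume "\<exists>i<N. v i \<noteq> 0"
  then have "vec N v \<noteq> 0\<^sub>v N" by (metis index_vec index_zero_vec(1))
  then have "(M *\<^sub>v vec N v) \<bullet>c vec N v > 0" using assms by (auto simp: pos_def_mat_def)
  moreover have "(M *\<^sub>v vec N v) \<bullet>c vec N v = qform N (\<lambda>i j. M $$ (i, j)) v"
    using M(1)
    by (auto simp: scalar_prod_def qform_def atLeast0LessThan sum_distrib_left sum_distrib_right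
        mult_ac intro!: sum.cong)
  ultimately show "0 < Re (qform N (\<lambda>i j. M $$ (i, j)) v)" by (simp add: less_complex_def)
qed

text \<open>The determinant is the product of the window's own pivots, which lie between the pivots
  of the whole matrix and the diagonal entries. The witness \<open>b\<close> also records that it is
  real.\<close>

lemma fischer_hadamard_det_bounds:
  assumes "pd n A" "ldl n A L s" "\<And>l. l < n \<Longrightarrow> s l > 0" "a + k \<le> n"
  shows "\<exists>b. det (mat k k (\<lambda>(i, j). A (a + i) (a + j))) = of_real b \<and>
    (\<Prod>p=a..<a+k. s p) \<le> b \<and> b \<le> (\<Prod>p=a..<a+k. Re (A p p))"
proof -
  obtain M t where M: "ldl k (\<lambda>i j. A (a + i) (a + j)) M t" and t: "\<And>l. l < k \<Longrightarrow> t l > 0"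
    using pd_ldl[OF pd_window[OF assms(1,4)]] by blast
  have shift: "(\<Prod>p=a..<a+k. f p) = (\<Prod>q<k. f (a + q))" for f :: "nat \<Rightarrow> real"
    using prod.shift_bounds_nat_ivl[of f 0 a k] by (simp add: atLeast0LessThan add.commute)
  have "(\<Prod>q<k. s (a + q)) \<le> (\<Prod>q<k. t q)"
    using pivot_le_window_pivot[OF assms(2,3) M assms(4)] assms(3,4)
    by (intro prod_mono) (auto intro: less_imp_le)
  moreover have "(\<Prod>q<k. t q) \<le> (\<Prod>q<k. Re (A (a + q) (a + q)))"
    using pivot_le_diagonal(2)[OF M t] t by (intro prod_mono) (auto intro: less_imp_le)
  ultimately show ?thesis using det_ldl[OF M] unfolding shift by blast
qed

section \<open>Assembling the bounds over all blocks\<close>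

theorem theorem1p2:
  fixes n k m :: nat and A :: "nat \<Rightarrow> complex mat"
  assumes "n \<ge> 1" and "k \<ge> 1" and "m \<ge> 2"
    and "\<And>i. i \<in> {1..m} \<Longrightarrow> pos_def_mat (n * k) (A i)"
  shows "det (hadamard_prod (n * k) m A) \<ge>
    det (matrix_prod (n * k) m A) *
    (\<Prod>\<mu> = 2..n.
       (\<Sum>i = 1..m.
          det (block k (A i) \<mu> \<mu>) * det (leading_block_submatrix k (A i) (\<mu> - 1)) /
          det (leading_block_submatrix k (A i) \<mu>))
       - (of_nat m - 1))"
proof -
  let ?N = "n * k"
  define E where "E i p q = A i $$ (p, q)" for i p q
  \<comment> \<open>Blocks are numbered from 0 here: \<open>B \<mu>\<close> belongs to block
    \<open>Suc \<mu>\<close> of the statement.\<close>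
  define B where "B \<mu> = {\<mu> * k..<\<mu> * k + k}" for \<mu>
  have carrier: "A i \<in> carrier_mat ?N ?N" if "i \<in> {1..m}" for i
    using assms(4)[OF that] by (simp add: pos_def_mat_def)
  have pd: "pd ?N (E i)" if "i \<in> {1..m}" for i
    using pos_def_mat_imp_pd[OF assms(4)[OF that]] unfolding E_def .
  have "\<forall>i\<in>{1..m}. \<exists>L s. ldl ?N (E i) L s \<and> (\<forall>l<?N. s l > 0)"
    using pd_ldl[OF pd] by blast
  then obtain L s where ldl: "\<And>i. i \<in> {1..m} \<Longrightarrow> ldl ?N (E i) (L i) (s i)"
    and s: "\<And>i l. i \<in> {1..m} \<Longrightarrow> l < ?N \<Longrightarrow> s i l > 0"
    by metis
  have "pd ?N (\<lambda>p q. \<Prod>i\<in>{1..m}. E i p q)"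
    using pd assms(3) by (intro pd_hadamard_prod) auto
  then obtain M h where M: "ldl ?N (\<lambda>p q. \<Prod>i\<in>{1..m}. E i p q) M h"
    using pd_ldl by blast
  have in_block: "p < ?N" if "\<mu> < n" "p \<in> B \<mu>" for \<mu> p
  proof -
    have "Suc \<mu> * k \<le> ?N" using that(1) by (intro mult_le_mono1) simp
    with that(2) show ?thesis by (auto simp: B_def)
  qed
  have block_le: "\<mu> * k + k \<le> ?N" if "\<mu> < n" for \<mu>
    using mult_le_mono1[of "Suc \<mu>" n k] that by simp
  have split: "(\<Prod>p<\<mu> * k. f p) = (\<Prod>\<nu><\<mu>. \<Prod>p\<in>B \<nu>. f p)" for \<mu> and f :: "nat \<Rightarrow> real"
    unfolding B_def using prod.nat_group[of f k \<mu>] by simp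

  have "\<forall>i\<in>{1..m}. \<forall>\<mu><n. \<exists>b. det (block k (A i) (Suc \<mu>) (Suc \<mu>)) = of_real b \<and>
      (\<Prod>p\<in>B \<mu>. s i p) \<le> b \<and> b \<le> (\<Prod>p\<in>B \<mu>. Re (E i p p))"
  proof (intro ballI allI impI)
    fix i \<mu> assume i: "i \<in> {1..m}" and \<mu>: "\<mu> < n"
    show "\<exists>b. det (block k (A i) (Suc \<mu>) (Suc \<mu>)) = of_real b \<and>
      (\<Prod>p\<in>B \<mu>. s i p) \<le> b \<and> b \<le> (\<Prod>p\<in>B \<mu>. Re (E i p p))"
      using fischer_hadamard_det_bounds[OF pd[OF i] ldl[OF i] s[OF i] block_le[OF \<mu>]]
      unfolding block_eq[OF carrier[OF i] \<mu>] B_def E_def by simp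
  qed
  then obtain b where b: "\<And>i \<mu>. i \<in> {1..m} \<Longrightarrow> \<mu> < n \<Longrightarrow>
      det (block k (A i) (Suc \<mu>) (Suc \<mu>)) = of_real (b i \<mu>) \<and>
      (\<Prod>p\<in>B \<mu>. s i p) \<le> b i \<mu> \<and> b i \<mu> \<le> (\<Prod>p\<in>B \<mu>. Re (E i p p))"
    by metis
  \<comment> \<open>For \<open>\<mu> \<ge> 1\<close> this is the factor with index
    \<open>Suc \<mu>\<close> in the statement: the quotient of consecutive leading block
    determinants is the product of the pivots in \<open>B \<mu>\<close>.\<close>
  define F where "F \<mu> = (\<Sum>i=1..m. b i \<mu> / (\<Prod>p\<in>B \<mu>. s i p)) - (real m - 1)" for \<mu>
  define S where "S \<mu> = (\<Prod>i=1..m. \<Prod>p\<in>B \<mu>. s i p)" for \<mu>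
  have S: "S \<mu> > 0" if "\<mu> < n" for \<mu>
    unfolding S_def using s in_block[OF that] by (intro prod_pos) auto
  have h: "h p \<ge> (\<Prod>i=1..m. Re (E i p p)) - (\<Prod>i=1..m. Re (E i p p) - s i p)" if "p < ?N" for p
    using pivot_hadamard_ge[of "{1..m}" ?N E L s p M h] ldl s M that by simp
  have sE: "s i p \<le> Re (E i p p)" if "i \<in> {1..m}" "p < ?N" for i p
    using pivot_le_diagonal(2)[OF ldl[OF that(1)] s[OF that(1)] that(2)] .
  have F: "F \<mu> \<ge> 1 \<and> (\<Prod>p\<in>B \<mu>. h p) \<ge> S \<mu> * F \<mu>" if "\<mu> < n" for \<mu>
    unfolding F_def S_def
    using prod_pivot_lower_bound[of m "B \<mu>" s "\<lambda>i p. Re (E i p p)" h "\<lambda>i. b i \<mu>"]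
      assms(3) s sE h b[OF _ that] in_block[OF that] by (simp add: B_def)

  have "det (hadamard_prod ?N m A) = of_real (\<Prod>p<?N. h p)"
    using det_ldl[OF M] hadamard_prod_eq[of m A ?N, OF carrier] by (simp add: E_def)
  moreover have "det (matrix_prod ?N m A) = of_real (\<Prod>\<mu><n. S \<mu>)"
  proof -
    have A: "det (A i) = of_real (\<Prod>\<mu><n. \<Prod>p\<in>B \<mu>. s i p)" if "i \<in> {1..m}" for i
    proof -
      have "mat ?N ?N (\<lambda>(p, q). E i p q) = A i"
        using carrier[OF that] by (auto simp: E_def)
      then show ?thesis using det_ldl[OF ldl[OF that]] by (simp add: split)
    qed
    have "det (matrix_prod ?N m A) = (\<Prod>i=1..m. det (A i))"
      using carrier by (rule det_matrix_prod)
    also have "\<dots> = of_real (\<Prod>i=1..m. \<Prod>\<mu><n. \<Prod>p\<in>B \<mu>. s i p)"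
      unfolding of_real_prod[of _ "{1..m}"] using A by (intro prod.cong refl)
    also have "(\<Prod>i=1..m. \<Prod>\<mu><n. \<Prod>p\<in>B \<mu>. s i p) = (\<Prod>\<mu><n. S \<mu>)"
      unfolding S_def by (rule prod.swap)
    finally show ?thesis .
  qed
  moreover have "(\<Prod>\<mu> = 2..n. (\<Sum>i = 1..m.
          det (block k (A i) \<mu> \<mu>) * det (leading_block_submatrix k (A i) (\<mu> - 1)) /
          det (leading_block_submatrix k (A i) \<mu>)) - (of_nat m - 1)) =
      of_real (\<Prod>\<mu>=1..<n. F \<mu>)"
  proof -
    have lead: "det (leading_block_submatrix k (A i) \<mu>) = of_real (\<Prod>\<nu><\<mu>. \<Prod>p\<in>B \<nu>. s i p)"
      if "i \<in> {1..m}" "\<mu> \<le> n" for i \<mu>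
    proof -
      have "ldl (\<mu> * k) (E i) (L i) (s i)"
        using that by (intro ldl_leading[OF ldl]) auto
      from det_ldl[OF this] show ?thesis
        by (simp add: leading_block_submatrix_eq[OF carrier[OF that(1)] that(2)] E_def split)
    qed
    have "det (block k (A i) (Suc \<mu>) (Suc \<mu>)) * det (leading_block_submatrix k (A i) \<mu>) /
        det (leading_block_submatrix k (A i) (Suc \<mu>)) = of_real (b i \<mu> / (\<Prod>p\<in>B \<mu>. s i p))"
      if "i \<in> {1..m}" "\<mu> < n" for i \<mu>
    proof -
      define P Q where "P = (\<Prod>\<nu><\<mu>. \<Prod>p\<in>B \<nu>. s i p)" and "Q = (\<Prod>p\<in>B \<mu>. s i p)"
      \<comment> \<open>Positivity lets \<open>P\<close> cancel from numerator and
        denominator.\<close>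
      have "P > 0"
        unfolding P_def split[symmetric] using that
        by (intro prod_pos s) (auto intro: less_le_trans[OF _ mult_le_mono1[of \<mu> n k]])
      moreover have "det (leading_block_submatrix k (A i) \<mu>) = of_real P"
        using lead[of i \<mu>] that by (simp add: P_def)
      moreover have "det (leading_block_submatrix k (A i) (Suc \<mu>)) = of_real (P * Q)"
        using lead[of i "Suc \<mu>"] that by (simp add: P_def Q_def)
      ultimately show ?thesis
        using b[OF that] by (simp add: Q_def[symmetric])
    qed
    then have "(\<Sum>i = 1..m.
          det (block k (A i) (Suc \<mu>) (Suc \<mu>)) * det (leading_block_submatrix k (A i) \<mu>) /
          det (leading_block_submatrix k (A i) (Suc \<mu>))) - (of_nat m - 1) = of_real (F \<mu>)"
      if "\<mu> < n" for \<mu>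
      using that by (simp add: F_def)
    then have "(\<Prod>\<mu>\<in>{1..<n}. (\<Sum>i = 1..m.
          det (block k (A i) (Suc \<mu>) (Suc \<mu>)) * det (leading_block_submatrix k (A i) (Suc \<mu> - 1)) /
          det (leading_block_submatrix k (A i) (Suc \<mu>))) - (of_nat m - 1)) =
        of_real (\<Prod>\<mu>=1..<n. F \<mu>)"
      unfolding of_real_prod by (intro prod.cong) auto
    moreover have "{2..n} = {Suc 1..<Suc n}" by auto
    ultimately show ?thesis by (simp only: prod.shift_bounds_Suc_ivl)
  qed
  moreover have "(\<Prod>p<?N. h p) \<ge> (\<Prod>\<mu><n. S \<mu>) * (\<Prod>\<mu>=1..<n. F \<mu>)"
  proof -
    have n: "{..<n} = insert 0 {1..<n}" using assms(1) by auto
    \<comment> \<open>The first block has no factor in the statement and is split off; its bound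
      \<open>S 0 * F 0\<close> is weakened to \<open>S 0\<close> using
      \<open>F 0 \<ge> 1\<close>.\<close>
    have "S 0 * (\<Prod>\<mu>=1..<n. S \<mu> * F \<mu>) \<le> (\<Prod>p\<in>B 0. h p) * (\<Prod>\<mu>=1..<n. \<Prod>p\<in>B \<mu>. h p)"
    proof (rule mult_mono)
      have "S 0 * 1 \<le> S 0 * F 0" using F[of 0] S[of 0] assms(1) by (intro mult_left_mono) auto
      then show "S 0 \<le> (\<Prod>p\<in>B 0. h p)" using F[of 0] assms(1) by simp
      then show "0 \<le> (\<Prod>p\<in>B 0. h p)" using S[of 0] assms(1) by simp
      have nonneg: "0 \<le> S \<mu> * F \<mu>" if "\<mu> < n" for \<mu>
        using S[OF that] F[OF that] by simp
      then show "0 \<le> (\<Prod>\<mu>=1..<n. S \<mu> * F \<mu>)" by (intro prod_nonneg) auto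
      show "(\<Prod>\<mu>=1..<n. S \<mu> * F \<mu>) \<le> (\<Prod>\<mu>=1..<n. \<Prod>p\<in>B \<mu>. h p)"
        using F nonneg by (intro prod_mono) auto
    qed
    then show ?thesis unfolding split n by (simp add: prod.distrib mult.assoc)
  qed
  \<comment> \<open>Both sides are embedded reals, so the complex order reduces to the real
    inequality.\<close>
  ultimately show ?thesis
    by (simp only: of_real_mult[symmetric] less_eq_complex_def Re_complex_of_real
        Im_complex_of_real simp_thms)
qed

end
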